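(* Let $0<\alpha<1$, $\theta=\alpha/2$, and let $0=t_0<t_1<\cdots<t_N=T$ be time levels whose local step-size ratios satisfy $\rho_k\le 7/4$ for $1\le k\le N-1$. Then the discrete kernels $A^{(n)}_{n-k}$ of the nonuniform Alikhanov formula (defined in the context) have the following properties. (I) For $1\le n\le N$, $$A_{0}^{(n)}\leq \frac{24}{11\tau_n}\int_{t_{n-1}}^{t_{n}}\omega_{1-\alpha}(t_n-s)\,ds,$$ and $$A_{n-k}^{(n)}\geq\frac{4}{11\tau_k}\int_{t_{k-1}}^{t_{k}}\omega_{1-\alpha}(t_n-s)\,ds,\qquad 1\le k\le n.$$ (II) For $2\le n\le N$ and $1\le k\le n-1$, $$A^{(n)}_{n-k-1}-A^{(n)}_{n-k}\ge (1+\rho_k)\,b^{(n)}_{n-k}+\frac{1}{5\tau_k}\int_{t_{k-1}}^{t_k}(t_k-s)\,\varpi_n''(s)\,ds .$$ (III) For $2\le n\le N$, $$\frac{1-2\theta}{1-\theta}A^{(n)}_{0}-A^{(n)}_{1}>0 .$$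
   Context: Notation. $\omega_\beta(t)=t^{\beta-1}/\Gamma(\beta)$ for $t>0$. Step sizes $\tau_k=t_k-t_{k-1}$ ($1\le k\le N$), ratios $\rho_k=\tau_k/\tau_{k+1}$ ($1\le k\le N-1$), $t_{n-\theta}=\theta t_{n-1}+(1-\theta)t_n$, $t_{k-1/2}=(t_{k-1}+t_k)/2$. For $0\le t\le t_{n-\theta}$ put $\varpi_n(t)=-\omega_{2-\alpha}(t_{n-\theta}-t)$, so that for $0\le t<t_{n-\theta}$: $\varpi_n'(t)=\omega_{1-\alpha}(t_{n-\theta}-t)>0$ and $\varpi_n''(t)=-\omega_{-\alpha}(t_{n-\theta}-t)>0$. Coefficients: $$a^{(n)}_{n-k}=\frac{1}{\tau_k}\int_{t_{k-1}}^{\min\{t_k,t_{n-\theta}\}}\varpi_n'(s)\,ds\quad(1\le k\le n),$$ $$b^{(n)}_{n-k}=\frac{2}{\tau_k(\tau_k+\tau_{k+1})}\int_{t_{k-1}}^{t_k}(s-t_{k-1/2})\varpi_n'(s)\,ds\quad(1\le k\le n-1).$$ Kernels: $A^{(1)}_0=a^{(1)}_0$ and, for $n\ge2$, $$A^{(n)}_{0}=a^{(n)}_0+\rho_{n-1}b^{(n)}_1,\qquad A^{(n)}_{n-k}=a^{(n)}_{n-k}+\rho_{k-1}b^{(n)}_{n-k+1}-b^{(n)}_{n-k}\ (2\le k\le n-1),\qquad A^{(n)}_{n-1}=a^{(n)}_{n-1}-b^{(n)}_{n-1}.$$ *)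

theory Defs
  imports "HOL-Analysis.Analysis"
begin

definition omega :: "real \<Rightarrow> real \<Rightarrow> real" where
  "omega \<beta> t = t powr (\<beta> - 1) / Gamma \<beta>"

definition step :: "(nat \<Rightarrow> real) \<Rightarrow> nat \<Rightarrow> real" where
  "step t k = t k - t (k - 1)"

definition ratio :: "(nat \<Rightarrow> real) \<Rightarrow> nat \<Rightarrow> real" where
  "ratio t k = step t k / step t (k + 1)"

definition offset_point :: "real \<Rightarrow> (nat \<Rightarrow> real) \<Rightarrow> nat \<Rightarrow> real" where
  "offset_point \<theta> t n = \<theta> * t (n - 1) + (1 - \<theta>) * t n"

definition midpoint_time :: "(nat \<Rightarrow> real) \<Rightarrow> nat \<Rightarrow> real" where
  "midpoint_time t k = (t (k - 1) + t k) / 2"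

definition varpi :: "real \<Rightarrow> real \<Rightarrow> (nat \<Rightarrow> real) \<Rightarrow> nat \<Rightarrow> real \<Rightarrow> real" where
  "varpi \<alpha> \<theta> t n s = - omega (2 - \<alpha>) (offset_point \<theta> t n - s)"

definition varpi1 :: "real \<Rightarrow> real \<Rightarrow> (nat \<Rightarrow> real) \<Rightarrow> nat \<Rightarrow> real \<Rightarrow> real" where
  "varpi1 \<alpha> \<theta> t n = deriv (varpi \<alpha> \<theta> t n)"

definition varpi2 :: "real \<Rightarrow> real \<Rightarrow> (nat \<Rightarrow> real) \<Rightarrow> nat \<Rightarrow> real \<Rightarrow> real" where
  "varpi2 \<alpha> \<theta> t n = deriv (varpi1 \<alpha> \<theta> t n)"

text \<open>The last argument of the coefficients and kernels below is the subscript \<open>j = n - k\<close>, so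
  the associated interval \<open>{t (k - 1)..t k}\<close> has \<open>k = n - j\<close>. Values outside the stated ranges
  (\<open>j < n\<close> for \<open>coeff_a\<close> and \<open>kernel_A\<close>, \<open>1 \<le> j < n\<close> for \<open>coeff_b\<close>) are irrelevant. For
  \<open>j = 0\<close> the integrand of \<open>coeff_a\<close> is weakly singular at the right end point; its value at that
  single point does not matter.\<close>

definition coeff_a :: "real \<Rightarrow> real \<Rightarrow> (nat \<Rightarrow> real) \<Rightarrow> nat \<Rightarrow> nat \<Rightarrow> real" where
  "coeff_a \<alpha> \<theta> t n j = (let k = n - j in
     1 / step t k *
     integral {t (k - 1)..min (t k) (offset_point \<theta> t n)} (varpi1 \<alpha> \<theta> t n))"

definition coeff_b :: "real \<Rightarrow> real \<Rightarrow> (nat \<Rightarrow> real) \<Rightarrow> nat \<Rightarrow> nat \<Rightarrow> real" where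
  "coeff_b \<alpha> \<theta> t n j = (let k = n - j in
     2 / (step t k * (step t k + step t (k + 1))) *
     integral {t (k - 1)..t k} (\<lambda>s. (s - midpoint_time t k) * varpi1 \<alpha> \<theta> t n s))"

definition kernel_A :: "real \<Rightarrow> real \<Rightarrow> (nat \<Rightarrow> real) \<Rightarrow> nat \<Rightarrow> nat \<Rightarrow> real" where
  "kernel_A \<alpha> \<theta> t n j = (
     if n = 1 then coeff_a \<alpha> \<theta> t 1 0
     else if j = 0 then coeff_a \<alpha> \<theta> t n 0 + ratio t (n - 1) * coeff_b \<alpha> \<theta> t n 1
     else if j = n - 1 then coeff_a \<alpha> \<theta> t n (n - 1) - coeff_b \<alpha> \<theta> t n (n - 1)
     else coeff_a \<alpha> \<theta> t n j + ratio t (n - j - 1) * coeff_b \<alpha> \<theta> t n (j + 1)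
          - coeff_b \<alpha> \<theta> t n j)"

lemma has_real_derivative_omega_reflected:
  assumes "s < c" and "\<beta> \<noteq> 1"
  shows "((\<lambda>s. - omega \<beta> (c - s)) has_real_derivative omega (\<beta> - 1) (c - s)) (at s)"
proof -
  have G: "(\<beta> - 1) / Gamma \<beta> = 1 / Gamma (\<beta> - 1)"
    using rGamma_plus1[of "\<beta> - 1"] assms(2) by (simp add: rGamma_inverse_Gamma field_simps)
  have "((\<lambda>s. (c - s) powr (\<beta> - 1)) has_real_derivative
          (\<beta> - 1) * (c - s) powr (\<beta> - 1 - 1) * (0 - 1)) (at s)"
    using assms(1)
    by (intro DERIV_chain2[OF has_real_derivative_powr] derivative_intros) auto
  from DERIV_minus[OF DERIV_cdivide[OF this, of "Gamma \<beta>"]]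
  have "((\<lambda>s. - ((c - s) powr (\<beta> - 1) / Gamma \<beta>)) has_real_derivative
          (\<beta> - 1) / Gamma \<beta> * (c - s) powr (\<beta> - 1 - 1)) (at s)"
    by simp
  then show ?thesis by (simp add: omega_def G)
qed

lemma varpi1_eq:
  assumes "0 < \<alpha>" "\<alpha> < 1" "s < offset_point \<theta> t n"
  shows "varpi1 \<alpha> \<theta> t n s = omega (1 - \<alpha>) (offset_point \<theta> t n - s)"
  using DERIV_imp_deriv[OF has_real_derivative_omega_reflected[OF assms(3), of "2 - \<alpha>"]] assms
  by (simp add: varpi1_def varpi_def[abs_def])

lemma varpi2_eq:
  assumes "0 < \<alpha>" "\<alpha> < 1" "s < offset_point \<theta> t n"
  shows "varpi2 \<alpha> \<theta> t n s = - omega (- \<alpha>) (offset_point \<theta> t n - s)"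
proof -
  let ?c = "offset_point \<theta> t n"
  have "((\<lambda>s. omega (1 - \<alpha>) (?c - s)) has_real_derivative - omega (- \<alpha>) (?c - s)) (at s)"
    using DERIV_minus[OF has_real_derivative_omega_reflected[OF assms(3), of "1 - \<alpha>"]] assms
    by simp
  then have "(varpi1 \<alpha> \<theta> t n has_real_derivative - omega (- \<alpha>) (?c - s)) (at s)"
    by (rule has_field_derivative_transform_within_open[of _ _ _ "{..<?c}"])
       (use assms in \<open>auto simp: varpi1_eq\<close>)
  then show ?thesis by (simp add: varpi2_def DERIV_imp_deriv)
qed

end

theory Submission
  imports Defs
begin

text \<open>
  Write \<open>\<phi>\<close> and \<open>\<psi>\<close> for the first and second derivative of \<open>varpi\<close>. To the left of its
  singularity \<open>\<phi>\<close> is positive, increasing and convex, and everything rests on that. For \<open>k < n\<close>,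
  integration by parts on the \<open>k\<close>-th interval, of length \<open>\<tau>\<^sub>k\<close>, expresses the coefficients through moments of \<open>\<psi>\<close>:
  the amounts by which the average \<open>a\<^sub>k\<close> of \<open>\<phi>\<close> exceeds the left end value and falls short of the
  right end value are
    \<^item> \<open>I\<^sub>k = a\<^sub>k - \<phi>(t\<^bsub>k-1\<^esub>)\<close>, the mean of \<open>(t\<^sub>k - s) \<psi>(s)\<close>, and
    \<^item> \<open>J\<^sub>k = \<phi>(t\<^sub>k) - a\<^sub>k\<close>, the mean of \<open>(s - t\<^bsub>k-1\<^esub>) \<psi>(s)\<close>,

  while \<open>b\<^sub>k\<close> is the mean of \<open>(s - t\<^bsub>k-1\<^esub>) (t\<^sub>k - s) \<psi>(s)\<close> divided by \<open>\<tau>\<^sub>k + \<tau>\<^bsub>k+1\<^esub>\<close>.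

  The difference of two consecutive kernels contains the term \<open>(1 + \<rho>\<^sub>k) b\<^sub>k\<close> of its lower bound
  exactly. What remains to be shown is
  \<open>a\<^bsub>k+1\<^esub> - b\<^bsub>k+1\<^esub> - a\<^sub>k - \<rho>\<^bsub>k-1\<^esub> b\<^bsub>k-1\<^esub> \<ge> I\<^sub>k / 5\<close>, and it splits at the value \<open>\<phi>(t\<^sub>k)\<close>.
    \<^item> Above it (\<open>next_ge_value\<close>): \<open>b\<^bsub>k+1\<^esub> \<le> I\<^bsub>k+1\<^esub>\<close> gives \<open>a\<^bsub>k+1\<^esub> - b\<^bsub>k+1\<^esub> \<ge> \<phi>(t\<^sub>k)\<close>. On the
      last interval there is no \<open>b\<close>, and \<open>\<theta> = \<alpha> / 2\<close> yields
      \<open>\<phi>(t\<^bsub>n-1\<^esub>) = (1 - \<alpha>) / (1 - \<theta>) a\<^sub>n \<le> a\<^sub>n\<close>.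
    \<^item> Below it (\<open>right_avg_dominates\<close>): \<open>J\<^sub>k \<ge> \<rho>\<^bsub>k-1\<^esub> b\<^bsub>k-1\<^esub> + I\<^sub>k / 5\<close>. Monotonicity of \<open>\<psi>\<close> gives
      \<open>J\<^sub>k \<ge> I\<^sub>k\<close> and \<open>J\<^sub>k \<ge> \<tau>\<^sub>k \<psi>(t\<^bsub>k-1\<^esub>) / 2\<close>, hence \<open>J\<^sub>k - I\<^sub>k / 5 \<ge> 2/5 \<tau>\<^sub>k \<psi>(t\<^bsub>k-1\<^esub>)\<close>; and the
      neighbouring term is at most \<open>r\<^sup>3 / (6 (1 + r)) \<tau>\<^sub>k \<psi>(t\<^bsub>k-1\<^esub>)\<close> with \<open>r = \<rho>\<^bsub>k-1\<^esub>\<close>,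
      where the factor is below \<open>1/3\<close> for \<open>r \<le> 7/4\<close>.

  That \<open>(1 - 2 \<theta>) / (1 - \<theta>)\<close> times the leading kernel exceeds the next one follows from
  \<open>J\<^sub>k > \<rho>\<^bsub>k-1\<^esub> b\<^bsub>k-1\<^esub>\<close> with \<open>k = n - 1\<close>, because \<open>(1 - 2 \<theta>) / (1 - \<theta>) = (1 - \<alpha>) / (1 - \<theta>)\<close>
  is precisely the factor that turns \<open>a\<^sub>n\<close> into \<open>\<phi>(t\<^bsub>n-1\<^esub>)\<close>. The two-sided bounds of the kernels follow from
  \<open>b\<^sub>k \<le> \<rho>\<^sub>k / (1 + \<rho>\<^sub>k) a\<^sub>k \<le> 7/11 a\<^sub>k\<close>: below, \<open>a\<^sub>k - b\<^sub>k \<ge> 4/11 a\<^sub>k\<close>; above,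
  \<open>\<rho>\<^bsub>n-1\<^esub> b\<^bsub>n-1\<^esub> \<le> 7/4 * 7/11 a\<^bsub>n-1\<^esub> \<le> 49/44 a\<^sub>n\<close>, and \<open>1 + 49/44 < 24/11\<close>.
  Only the last interval needs its coefficient in closed form, \<open>a\<^sub>n\<close> being a pure power of \<open>\<tau>\<^sub>n\<close>.
\<close>

section \<open>Moments of an increasing convex function on one interval\<close>

locale convex_profile =
  fixes f g :: "real \<Rightarrow> real" and a b :: real
  assumes nonempty: "a < b"
    and deriv: "\<And>s. s \<in> {a..b} \<Longrightarrow> (f has_real_derivative g s) (at s)"
    and slope_continuous: "continuous_on {a..b} g"
    and slope_mono: "\<And>x y. a \<le> x \<Longrightarrow> x \<le> y \<Longrightarrow> y \<le> b \<Longrightarrow> g x \<le> g y"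
    and slope_pos: "\<And>s. s \<in> {a..b} \<Longrightarrow> 0 < g s"
    and value_pos: "\<And>s. s \<in> {a..b} \<Longrightarrow> 0 < f s"
begin

lemma continuous: "continuous_on {a..b} f"
  by (meson DERIV_isCont deriv continuous_at_imp_continuous_on)

lemma value_le_right:
  assumes "s \<in> {a..b}"
  shows "f s \<le> f b"
proof (rule DERIV_nonneg_imp_nondecreasing[where a = s and b = b and f = f])
  show "s \<le> b" using assms by simp
  fix x assume "s \<le> x" "x \<le> b"
  then have "x \<in> {a..b}" using assms by simp
  then show "\<exists>y. (f has_real_derivative y) (at x) \<and> 0 \<le> y"
    using deriv slope_pos less_imp_le by blast
qed

lemma integrals_exist:
  "f integrable_on {a..b}" "g integrable_on {a..b}"
  "(\<lambda>s. (s - a) * g s) integrable_on {a..b}"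
  "(\<lambda>s. (b - s) * g s) integrable_on {a..b}"
  "(\<lambda>s. (s - (a + b) / 2) * f s) integrable_on {a..b}"
  "(\<lambda>s. (s - a) * (b - s) * g s) integrable_on {a..b}"
  "(\<lambda>s. (s - (a + b) / 2) * g s) integrable_on {a..b}"
  by (intro integrable_continuous_real continuous_intros continuous slope_continuous)+

text \<open>Integration by parts, with an antiderivative that vanishes at an end point of the
  interval. The next two identities arise in the same way.\<close>

lemma right_moment:
  "integral {a..b} (\<lambda>s. (s - a) * g s) = (b - a) * f b - integral {a..b} f"
proof -
  have "((\<lambda>s. f s + (s - a) * g s) has_integral ((b - a) * f b - (a - a) * f a)) {a..b}"
    by (rule fundamental_theorem_of_calculus)
       (use nonempty in \<open>auto simp flip: has_real_derivative_iff_has_vector_derivative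
          intro!: derivative_eq_intros DERIV_subset[OF deriv]\<close>)
  then have "integral {a..b} (\<lambda>s. f s + (s - a) * g s) = (b - a) * f b"
    by (simp add: integral_unique)
  then show ?thesis by (simp add: integral_add integrals_exist)
qed

lemma left_moment:
  "integral {a..b} (\<lambda>s. (b - s) * g s) = integral {a..b} f - (b - a) * f a"
proof -
  have "((\<lambda>s. (b - s) * g s - f s) has_integral ((b - b) * f b - (b - a) * f a)) {a..b}"
    by (rule fundamental_theorem_of_calculus)
       (use nonempty in \<open>auto simp flip: has_real_derivative_iff_has_vector_derivative
          intro!: derivative_eq_intros DERIV_subset[OF deriv]\<close>)
  then have "integral {a..b} (\<lambda>s. (b - s) * g s - f s) = - ((b - a) * f a)"
    by (simp add: integral_unique)
  then show ?thesis by (simp add: integral_diff integrals_exist)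
qed

lemma centred_moment:
  "integral {a..b} (\<lambda>s. (s - (a + b) / 2) * f s) =
     1 / 2 * integral {a..b} (\<lambda>s. (s - a) * (b - s) * g s)"
proof -
  have "((\<lambda>s. (s - (a + b) / 2) * f s - 1 / 2 * ((s - a) * (b - s) * g s)) has_integral
      (- (1 / 2) * ((b - a) * (b - b)) * f b - - (1 / 2) * ((a - a) * (b - a)) * f a)) {a..b}"
    \<comment> \<open>the antiderivative is \<open>-(s - a) (b - s) f(s) / 2\<close>\<close>
    by (rule fundamental_theorem_of_calculus)
       (use nonempty in \<open>auto simp flip: has_real_derivative_iff_has_vector_derivative
          intro!: derivative_eq_intros DERIV_subset[OF deriv] simp: field_simps\<close>)
  then have "integral {a..b} (\<lambda>s. (s - (a + b) / 2) * f s - 1 / 2 * ((s - a) * (b - s) * g s)) = 0"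
    by (simp add: integral_unique)
  then show ?thesis
    by (subst (asm) integral_diff) (auto intro!: integrals_exist integrable_on_cmult_left)
qed

text \<open>Chebyshev's inequality: the difference of the two weights is \<open>2 (s - m)\<close> with \<open>m\<close> the
  midpoint, it integrates to zero, and it correlates nonnegatively with the increasing slope.\<close>

lemma left_le_right_moment:
  "integral {a..b} (\<lambda>s. (b - s) * g s) \<le> integral {a..b} (\<lambda>s. (s - a) * g s)"
proof -
  let ?m = "(a + b) / 2"
  have "((\<lambda>s. (s - ?m) * g ?m) has_integral ((b - ?m)^2 / 2 * g ?m - (a - ?m)^2 / 2 * g ?m)) {a..b}"
    by (rule fundamental_theorem_of_calculus)
       (use nonempty in \<open>auto simp flip: has_real_derivative_iff_has_vector_derivative
          intro!: derivative_eq_intros\<close>)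
  then have centre: "((\<lambda>s. (s - ?m) * g ?m) has_integral 0) {a..b}"
    by (simp add: power2_eq_square field_simps)
  have "0 \<le> integral {a..b} (\<lambda>s. (s - ?m) * g s)"
  proof (rule has_integral_le[OF centre integrable_integral[OF integrals_exist(7)]])
    fix s assume s: "s \<in> {a..b}"
    show "(s - ?m) * g ?m \<le> (s - ?m) * g s"
    proof (cases "?m \<le> s")
      case True
      then show ?thesis using s slope_mono[of ?m s] nonempty by (intro mult_left_mono) auto
    next
      case False
      then show ?thesis using s slope_mono[of s ?m] nonempty by (intro mult_left_mono_neg) auto
    qed
  qed
  also have "integral {a..b} (\<lambda>s. (s - ?m) * g s) =
      1 / 2 * integral {a..b} (\<lambda>s. (s - a) * g s - (b - s) * g s)"
    unfolding integral_mult_right[symmetric]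
    by (rule integral_cong) (simp add: field_simps)
  also have "\<dots> = 1 / 2 * (integral {a..b} (\<lambda>s. (s - a) * g s) - integral {a..b} (\<lambda>s. (b - s) * g s))"
    by (simp only: integral_diff[OF integrals_exist(3,4)])
  finally show ?thesis by simp
qed

lemma right_moment_ge:
  "g a * (b - a)\<^sup>2 / 2 \<le> integral {a..b} (\<lambda>s. (s - a) * g s)"
proof -
  have "((\<lambda>s. (s - a) * g a) has_integral ((b - a)^2 / 2 * g a - (a - a)^2 / 2 * g a)) {a..b}"
    by (rule fundamental_theorem_of_calculus)
       (use nonempty in \<open>auto simp flip: has_real_derivative_iff_has_vector_derivative
          intro!: derivative_eq_intros\<close>)
  then have "((b - a)^2 / 2 * g a - (a - a)^2 / 2 * g a) \<le> integral {a..b} (\<lambda>s. (s - a) * g s)"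
    by (rule has_integral_le[OF _ integrable_integral[OF integrals_exist(3)]])
       (auto intro!: mult_left_mono slope_mono)
  then show ?thesis by (simp add: mult.commute)
qed

lemma product_moment_le:
  "integral {a..b} (\<lambda>s. (s - a) * (b - s) * g s) \<le> g b * (b - a) ^ 3 / 6"
proof -
  \<comment> \<open>an antiderivative of \<open>(s - a) (b - s)\<close>, written in powers of \<open>s - a\<close>\<close>
  let ?P = "\<lambda>s. (b - a) * (s - a)^2 / 2 - (s - a)^3 / 3"
  have "((\<lambda>s. (s - a) * (b - s) * g b) has_integral (?P b * g b - ?P a * g b)) {a..b}"
    by (rule fundamental_theorem_of_calculus)
       (use nonempty in \<open>auto simp flip: has_real_derivative_iff_has_vector_derivative
          intro!: derivative_eq_intros simp: power2_eq_square field_simps\<close>)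
  then have "integral {a..b} (\<lambda>s. (s - a) * (b - s) * g s) \<le> ?P b * g b - ?P a * g b"
    by (rule has_integral_le[OF integrable_integral[OF integrals_exist(6)]])
       (auto intro!: mult_left_mono slope_mono)
  also have "\<dots> = g b * (b - a) ^ 3 / 6"
    by (simp add: power2_eq_square power3_eq_cube)
  finally show ?thesis .
qed

lemma product_moment_le_left_moment:
  "integral {a..b} (\<lambda>s. (s - a) * (b - s) * g s) \<le>
     (b - a) * integral {a..b} (\<lambda>s. (b - s) * g s)"
  unfolding integral_mult_right[symmetric]
proof (rule integral_le[OF integrals_exist(6) integrable_on_mult_right[OF integrals_exist(4)]])
  fix s assume s: "s \<in> {a..b}"
  then have "0 \<le> (b - s) * g s" by (simp add: less_imp_le[OF slope_pos])
  then show "(s - a) * (b - s) * g s \<le> (b - a) * ((b - s) * g s)"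
    unfolding mult.assoc using s by (intro mult_right_mono) auto
qed

lemma product_moment_nonneg:
  "0 \<le> integral {a..b} (\<lambda>s. (s - a) * (b - s) * g s)"
  by (rule integral_nonneg)
     (auto intro!: integrals_exist mult_nonneg_nonneg less_imp_le[OF slope_pos])

lemma centred_moment_le:
  "integral {a..b} (\<lambda>s. (s - (a + b) / 2) * f s) \<le> (b - a) / 2 * integral {a..b} f"
  unfolding integral_mult_right[symmetric]
  by (rule integral_le[OF integrals_exist(5) integrable_on_mult_right[OF integrals_exist(1)]])
     (auto intro!: mult_right_mono less_imp_le[OF value_pos] simp: field_simps)

lemma integral_le_right:
  "integral {a..b} f \<le> (b - a) * f b"
proof -
  have "((\<lambda>s. f b) has_integral ((b - a) * f b)) {a..b}"
    using nonempty has_integral_const_real[of "f b" a b] by simp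
  from has_integral_le[OF integrable_integral[OF integrals_exist(1)] this value_le_right]
  show ?thesis by simp
qed

end


section \<open>The power kernel\<close>

lemma omega_pos: "0 < x \<Longrightarrow> 0 < \<beta> \<Longrightarrow> 0 < omega \<beta> x"
  by (simp add: omega_def)

lemma omega_antimono:
  assumes "0 < \<beta>" "\<beta> \<le> 1" "0 < x" "x \<le> y"
  shows "omega \<beta> y \<le> omega \<beta> x"
  using assms unfolding omega_def by (intro divide_right_mono powr_mono2') (auto simp: less_imp_le)

lemma omega_mono:
  assumes "1 \<le> \<beta>" "0 \<le> x" "x \<le> y"
  shows "omega \<beta> x \<le> omega \<beta> y"
  using assms unfolding omega_def by (intro divide_right_mono powr_mono2) (auto simp: less_imp_le)

lemma omega_plus_one:
  assumes "0 < \<beta>" "0 < x"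
  shows "omega (\<beta> + 1) x = x / \<beta> * omega \<beta> x"
proof -
  have "Gamma (\<beta> + 1) = \<beta> * Gamma \<beta>"
    using assms by (intro Gamma_plus1) (auto elim!: nonpos_Ints_cases)
  then show ?thesis using assms by (simp add: omega_def powr_diff)
qed

lemma omega_zero [simp]: "omega \<beta> 0 = 0"
  by (simp add: omega_def)

lemma minus_omega_minus:
  assumes "0 < \<alpha>" "\<alpha> < 1"
  shows "- omega (- \<alpha>) x = \<alpha> / Gamma (1 - \<alpha>) * x powr (- \<alpha> - 1)"
proof -
  have "rGamma (- \<alpha>) = - \<alpha> * rGamma (1 - \<alpha>)"
    using rGamma_plus1[of "- \<alpha>"] by simp
  moreover have "omega (- \<alpha>) x = x powr (- \<alpha> - 1) * rGamma (- \<alpha>)"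
    by (simp add: omega_def rGamma_inverse_Gamma divide_inverse)
  ultimately show ?thesis
    by (simp add: rGamma_inverse_Gamma divide_inverse)
qed

lemma has_integral_omega:
  assumes "0 < \<alpha>" "\<alpha> < 1" "a \<le> b" "b \<le> d"
  shows "((\<lambda>s. omega (1 - \<alpha>) (d - s)) has_integral
            omega (2 - \<alpha>) (d - a) - omega (2 - \<alpha>) (d - b)) {a..b}"
proof -
  have "0 < Gamma (2 - \<alpha>)"
    using assms by (intro Gamma_real_pos) simp
  then have "Gamma (2 - \<alpha>) \<noteq> 0" by (metis less_irrefl)
  have "((\<lambda>s. omega (1 - \<alpha>) (d - s)) has_integral
            - omega (2 - \<alpha>) (d - b) - - omega (2 - \<alpha>) (d - a)) {a..b}"
  proof (rule fundamental_theorem_of_calculus_interior)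
    show "continuous_on {a..b} (\<lambda>s. - omega (2 - \<alpha>) (d - s))"
      unfolding omega_def using assms \<open>Gamma (2 - \<alpha>) \<noteq> 0\<close>
      by (intro continuous_on_minus continuous_on_divide continuous_on_powr' continuous_on_diff
            continuous_on_const continuous_on_id) auto
    fix s assume "s \<in> {a<..<b}"
    then show "((\<lambda>s. - omega (2 - \<alpha>) (d - s)) has_vector_derivative omega (1 - \<alpha>) (d - s)) (at s)"
      using has_real_derivative_omega_reflected[of s d "2 - \<alpha>"] assms
      by (simp add: has_real_derivative_iff_has_vector_derivative)
  qed (use assms in auto)
  then show ?thesis by simp
qed

text \<open>The function is concave and vanishes at 0.\<close>

lemma omega_scale_ge:
  assumes "0 < \<alpha>" "\<alpha> < 1" "0 < x" "0 < r" "r \<le> 1"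
  shows "r * omega (2 - \<alpha>) x \<le> omega (2 - \<alpha>) (r * x)"
proof -
  have "r powr 1 \<le> r powr (1 - \<alpha>)"
    using assms by (intro powr_mono') auto
  moreover have "0 < omega (2 - \<alpha>) x"
    using assms by (intro omega_pos) auto
  moreover have "omega (2 - \<alpha>) (r * x) = r powr (1 - \<alpha>) * omega (2 - \<alpha>) x"
    using assms by (simp add: omega_def powr_mult)
  ultimately show ?thesis using assms by simp
qed

section \<open>Estimates for the coefficients on a mesh\<close>

text \<open>Coefficients and kernels are indexed here by the number \<open>k\<close> of the interval that they belong
  to, instead of the distance \<open>n - k\<close>.\<close>

locale alikhanov_mesh =
  fixes \<alpha> :: real and t :: "nat \<Rightarrow> real" and N :: nat
  assumes order_pos: "0 < \<alpha>" and order_less_one: "\<alpha> < 1"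
    and nodes: "\<And>k. 1 \<le> k \<Longrightarrow> k \<le> N \<Longrightarrow> t (k - 1) < t k"
    and ratios: "\<And>k. 1 \<le> k \<Longrightarrow> k \<le> N - 1 \<Longrightarrow> ratio t k \<le> 7 / 4"
begin

abbreviation c where "c \<equiv> offset_point (\<alpha> / 2) t"
abbreviation \<phi> where "\<phi> n s \<equiv> omega (1 - \<alpha>) (c n - s)"
abbreviation \<psi> where "\<psi> n s \<equiv> - omega (- \<alpha>) (c n - s)"
abbreviation a where "a n k \<equiv> coeff_a \<alpha> (\<alpha> / 2) t n (n - k)"
abbreviation b where "b n k \<equiv> coeff_b \<alpha> (\<alpha> / 2) t n (n - k)"
abbreviation \<tau> where "\<tau> \<equiv> step t"
abbreviation \<rho> where "\<rho> \<equiv> ratio t"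

lemma step_pos: "1 \<le> k \<Longrightarrow> k \<le> N \<Longrightarrow> 0 < \<tau> k"
  using nodes by (simp add: step_def)

lemma ratio_pos: "1 \<le> k \<Longrightarrow> k \<le> N - 1 \<Longrightarrow> 0 < \<rho> k"
  using step_pos by (auto simp: ratio_def)

lemma step_ratio: "1 \<le> k \<Longrightarrow> k < n \<Longrightarrow> n \<le> N \<Longrightarrow> \<tau> k = \<rho> k * \<tau> (k + 1)"
  using step_pos[of "k + 1"] by (simp add: ratio_def)

lemma nodes_mono: "k \<le> m \<Longrightarrow> m \<le> N \<Longrightarrow> t k \<le> t m"
proof (induction m rule: dec_induct)
  case (step m)
  then show ?case using nodes[of "Suc m"] by simp
qed simp

lemma offset_minus_left: "c n - t (n - 1) = (1 - \<alpha> / 2) * \<tau> n"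
  by (simp add: offset_point_def step_def algebra_simps)

lemma offset_le_right:
  assumes "1 \<le> n" "n \<le> N"
  shows "c n \<le> t n"
proof -
  have "t n - c n = \<alpha> / 2 * \<tau> n"
    by (simp add: offset_point_def step_def algebra_simps)
  then show ?thesis using step_pos[OF assms] order_pos
    by (metis diff_ge_0_iff_ge divide_nonneg_pos less_imp_le mult_nonneg_nonneg zero_less_numeral)
qed

lemma node_less_offset:
  assumes "k < n" "n \<le> N"
  shows "t k < c n"
proof -
  have "0 < (1 - \<alpha> / 2) * \<tau> n" using step_pos[of n] assms order_less_one by simp
  then have "t (n - 1) < c n" using offset_minus_left[of n] by linarith
  moreover have "t k \<le> t (n - 1)" using assms by (intro nodes_mono) auto
  ultimately show ?thesis by simp
qed

lemma profile:
  assumes "1 \<le> k" "k < n" "n \<le> N"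
  shows "convex_profile (\<phi> n) (\<psi> n) (t (k - 1)) (t k)"
proof
  note al = order_pos order_less_one
  have left: "s < c n" if "s \<le> t k" for s
    using node_less_offset[of k n] assms that by simp
  show "t (k - 1) < t k" using nodes assms by simp
  fix s assume "s \<in> {t (k - 1)..t k}"
  then have s: "s < c n" using left by simp
  show "0 < \<phi> n s" using s al by (intro omega_pos) auto
  show "0 < \<psi> n s" unfolding minus_omega_minus[OF al] using s al by simp
  show "(\<phi> n has_real_derivative \<psi> n s) (at s)"
    using DERIV_minus[OF has_real_derivative_omega_reflected[OF s, of "1 - \<alpha>"]] al by simp
next
  have ne: "c n - s \<noteq> 0" if "s \<in> {t (k - 1)..t k}" for s
    using node_less_offset[of k n] assms that by simp
  show "continuous_on {t (k - 1)..t k} (\<psi> n)"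
    unfolding minus_omega_minus[OF order_pos order_less_one] using ne
    by (intro continuous_intros) auto
  fix x y assume "t (k - 1) \<le> x" "x \<le> y" "y \<le> t k"
  then show "\<psi> n x \<le> \<psi> n y"
    unfolding minus_omega_minus[OF order_pos order_less_one]
    using node_less_offset[of k n] assms order_pos order_less_one
    by (intro mult_left_mono powr_mono2') auto
qed

lemma coeff_a_interior:
  assumes "1 \<le> k" "k < n" "n \<le> N"
  shows "a n k = 1 / \<tau> k * integral {t (k - 1)..t k} (\<phi> n)"
proof -
  have "t k < c n" using node_less_offset assms by simp
  moreover from this have "integral {t (k - 1)..t k} (varpi1 \<alpha> (\<alpha> / 2) t n) = integral {t (k - 1)..t k} (\<phi> n)"
    by (intro integral_cong varpi1_eq[OF order_pos order_less_one]) auto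
  ultimately show ?thesis using assms by (simp add: coeff_a_def Let_def)
qed

lemma coeff_a_last:
  assumes "1 \<le> n" "n \<le> N"
  shows "a n n = omega (2 - \<alpha>) ((1 - \<alpha> / 2) * \<tau> n) / \<tau> n"
proof -
  have "t (n - 1) < c n" using node_less_offset assms by simp
  have "integral {t (n - 1)..c n} (varpi1 \<alpha> (\<alpha> / 2) t n) = integral {t (n - 1)..c n} (\<phi> n)"
    by (rule integral_spike[of "{c n}"]) (auto simp: varpi1_eq[OF order_pos order_less_one])
  also have "\<dots> = omega (2 - \<alpha>) ((1 - \<alpha> / 2) * \<tau> n)"
    using integral_unique[OF has_integral_omega[of \<alpha> "t (n - 1)" "c n" "c n"]]
      \<open>t (n - 1) < c n\<close> order_pos order_less_one
    unfolding offset_minus_left by simp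
  finally show ?thesis using offset_le_right[OF assms] by (simp add: coeff_a_def Let_def min_def)
qed

text \<open>For a pure power, average and end value differ by a constant factor. It
  links the last coefficient to the intervals before it.\<close>

lemma coeff_a_last_eq_value:
  assumes "1 \<le> n" "n \<le> N"
  shows "(1 - \<alpha>) / (1 - \<alpha> / 2) * a n n = \<phi> n (t (n - 1))"
proof -
  have "omega (1 - \<alpha> + 1) ((1 - \<alpha> / 2) * \<tau> n) =
      (1 - \<alpha> / 2) * \<tau> n / (1 - \<alpha>) * omega (1 - \<alpha>) ((1 - \<alpha> / 2) * \<tau> n)"
    using order_less_one step_pos[OF assms] by (intro omega_plus_one) auto
  moreover have "1 - \<alpha> + 1 = 2 - \<alpha>" by simp
  ultimately show ?thesis
    using order_less_one step_pos[OF assms]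
    unfolding coeff_a_last[OF assms] offset_minus_left by (simp add: field_simps)
qed

lemma coeff_b_interior:
  assumes "1 \<le> k" "k < n" "n \<le> N"
  shows "b n k = 2 / (\<tau> k * (\<tau> k + \<tau> (k + 1))) *
           integral {t (k - 1)..t k} (\<lambda>s. (s - (t (k - 1) + t k) / 2) * \<phi> n s)"
proof -
  have "t k < c n" using node_less_offset assms by simp
  then have "integral {t (k - 1)..t k} (\<lambda>s. (s - midpoint_time t k) * varpi1 \<alpha> (\<alpha> / 2) t n s)
      = integral {t (k - 1)..t k} (\<lambda>s. (s - (t (k - 1) + t k) / 2) * \<phi> n s)"
    by (intro integral_cong) (auto simp: varpi1_eq[OF order_pos order_less_one] midpoint_time_def)
  then show ?thesis using assms by (simp add: coeff_b_def Let_def)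
qed

lemma coeff_b_moment:
  assumes "1 \<le> k" "k < n" "n \<le> N"
  shows "b n k = 1 / (\<tau> k * (\<tau> k + \<tau> (k + 1))) *
           integral {t (k - 1)..t k} (\<lambda>s. (s - t (k - 1)) * (t k - s) * \<psi> n s)"
  unfolding coeff_b_interior[OF assms] convex_profile.centred_moment[OF profile[OF assms]]
  by simp

lemma coeff_b_nonneg:
  assumes "1 \<le> k" "k < n" "n \<le> N"
  shows "0 \<le> b n k"
  unfolding coeff_b_moment[OF assms]
  using convex_profile.product_moment_nonneg[OF profile[OF assms]]
    step_pos[of k] step_pos[of "k + 1"] assms
  by (intro mult_nonneg_nonneg) auto

lemma coeff_a_nonneg:
  assumes "1 \<le> k" "k < n" "n \<le> N"
  shows "0 \<le> a n k"
proof -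
  interpret convex_profile "\<phi> n" "\<psi> n" "t (k - 1)" "t k" by (rule profile[OF assms])
  have "0 \<le> integral {t (k - 1)..t k} (\<phi> n)"
    using integrals_exist(1) value_pos by (intro integral_nonneg) (auto intro: less_imp_le)
  then show ?thesis unfolding coeff_a_interior[OF assms]
    using step_pos[of k] assms by simp
qed

lemma ratio_fraction:
  assumes "1 \<le> k" "k < n" "n \<le> N"
  shows "\<tau> k / (\<tau> k + \<tau> (k + 1)) \<le> 7 / 11"
proof -
  have "\<rho> k \<le> 7 / 4" using ratios assms by simp
  then have "\<tau> k \<le> 7 / 4 * \<tau> (k + 1)"
    unfolding step_ratio[OF assms] using step_pos[of "k + 1"] assms by (intro mult_right_mono) auto
  then show ?thesis using step_pos[of k] step_pos[of "k + 1"] assms by (simp add: field_simps)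
qed

text \<open>On the interval \<open>s - t\<^bsub>k-1/2\<^esub> \<le> \<tau>\<^sub>k / 2\<close>; this leaves the factor
  \<open>\<tau>\<^sub>k / (\<tau>\<^sub>k + \<tau>\<^bsub>k+1\<^esub>)\<close>.\<close>

lemma coeff_b_le_coeff_a:
  assumes "1 \<le> k" "k < n" "n \<le> N"
  shows "b n k \<le> 7 / 11 * a n k"
proof -
  interpret convex_profile "\<phi> n" "\<psi> n" "t (k - 1)" "t k" by (rule profile[OF assms])
  have pos: "0 < \<tau> k" "0 < \<tau> (k + 1)" using step_pos assms by auto
  have "b n k \<le> 2 / (\<tau> k * (\<tau> k + \<tau> (k + 1))) * (\<tau> k / 2 * integral {t (k - 1)..t k} (\<phi> n))"
    unfolding coeff_b_interior[OF assms]
    using centred_moment_le pos by (intro mult_left_mono) (auto simp: step_def)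
  also have "\<dots> = \<tau> k / (\<tau> k + \<tau> (k + 1)) * a n k"
  proof -
    have "2 / (h * d) * (h / 2 * x) = h / d * (1 / h * x)" if "0 < h" for h d x :: real
      using that by simp
    then show ?thesis unfolding coeff_a_interior[OF assms] using pos by blast
  qed
  also have "\<dots> \<le> 7 / 11 * a n k"
    using ratio_fraction[OF assms] coeff_a_nonneg[OF assms] by (intro mult_right_mono)
  finally show ?thesis .
qed

lemma coeff_a_le_value:
  assumes "1 \<le> k" "k < n" "n \<le> N"
  shows "a n k \<le> \<phi> n (t k)"
  using convex_profile.integral_le_right[OF profile[OF assms]] step_pos[of k] assms
  unfolding coeff_a_interior[OF assms] by (simp add: field_simps step_def)

text \<open>The averages \<open>I\<^sub>k\<close> and \<open>J\<^sub>k\<close> of the introduction.\<close>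

definition left_avg where
  "left_avg n k = 1 / \<tau> k * integral {t (k - 1)..t k} (\<lambda>s. (t k - s) * \<psi> n s)"

definition right_avg where
  "right_avg n k = 1 / \<tau> k * integral {t (k - 1)..t k} (\<lambda>s. (s - t (k - 1)) * \<psi> n s)"

lemma right_avg_eq:
  assumes "1 \<le> k" "k < n" "n \<le> N"
  shows "right_avg n k = \<phi> n (t k) - a n k"
  unfolding right_avg_def coeff_a_interior[OF assms]
    convex_profile.right_moment[OF profile[OF assms]]
  using step_pos[of k] assms by (simp add: field_simps step_def)

lemma left_avg_eq:
  assumes "1 \<le> k" "k < n" "n \<le> N"
  shows "left_avg n k = a n k - \<phi> n (t (k - 1))"
  unfolding left_avg_def coeff_a_interior[OF assms]
    convex_profile.left_moment[OF profile[OF assms]]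
  using step_pos[of k] assms by (simp add: field_simps step_def)

lemma left_avg_le_right_avg:
  assumes "1 \<le> k" "k < n" "n \<le> N"
  shows "left_avg n k \<le> right_avg n k"
  unfolding left_avg_def right_avg_def
  using convex_profile.left_le_right_moment[OF profile[OF assms]] step_pos[of k] assms
  by (intro mult_left_mono) auto

lemma right_avg_ge:
  assumes "1 \<le> k" "k < n" "n \<le> N"
  shows "\<tau> k * \<psi> n (t (k - 1)) / 2 \<le> right_avg n k"
proof -
  have pos: "0 < \<tau> k" using step_pos assms by simp
  have "\<tau> k * \<psi> n (t (k - 1)) / 2 = 1 / \<tau> k * (\<psi> n (t (k - 1)) * (t k - t (k - 1))\<^sup>2 / 2)"
    unfolding step_def[symmetric] using pos by (simp add: power2_eq_square)
  also have "\<dots> \<le> right_avg n k"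
    unfolding right_avg_def
    using convex_profile.right_moment_ge[OF profile[OF assms]] pos by (intro mult_left_mono) auto
  finally show ?thesis .
qed

lemma coeff_b_le_left_avg:
  assumes "1 \<le> k" "k < n" "n \<le> N"
  shows "b n k \<le> left_avg n k"
proof -
  interpret convex_profile "\<phi> n" "\<psi> n" "t (k - 1)" "t k" by (rule profile[OF assms])
  have pos: "0 < \<tau> k" "0 < \<tau> (k + 1)" using step_pos assms by auto
  have nn: "0 \<le> integral {t (k - 1)..t k} (\<lambda>s. (t k - s) * \<psi> n s)"
    by (rule integral_nonneg[OF integrals_exist(4)], rule mult_nonneg_nonneg)
       (use slope_pos in \<open>force intro: less_imp_le\<close>)+
  have "b n k \<le> 1 / (\<tau> k * (\<tau> k + \<tau> (k + 1))) *
      (\<tau> k * integral {t (k - 1)..t k} (\<lambda>s. (t k - s) * \<psi> n s))"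
    unfolding coeff_b_moment[OF assms]
    using product_moment_le_left_moment pos by (intro mult_left_mono) (auto simp: step_def)
  also have "\<dots> = \<tau> k / (\<tau> k + \<tau> (k + 1)) * left_avg n k"
    using pos by (simp add: left_avg_def)
  also have "\<dots> \<le> 1 * left_avg n k"
    unfolding left_avg_def using pos nn by (intro mult_right_mono mult_nonneg_nonneg) auto
  finally show ?thesis by simp
qed

text \<open>The only real root of \<open>2 + 2 r - r\<^sup>3\<close> lies near \<open>1.77\<close>, just beyond \<open>7/4\<close>.\<close>

lemma ratio_cubed:
  fixes r :: real
  assumes "0 \<le> r" "r \<le> 7 / 4"
  shows "r ^ 3 \<le> 2 + 2 * r"
proof -
  have "r ^ 2 \<le> (7 / 4) ^ 2" using assms by (intro power_mono) auto
  then have "r * r ^ 2 \<le> r * (49 / 16)" using assms by (intro mult_left_mono) (auto simp: power2_eq_square)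
  then show ?thesis using assms by (simp add: power3_eq_cube power2_eq_square)
qed

text \<open>The contribution of the preceding interval is bounded by the slope at the common node, which
  is the largest slope on that interval and the smallest one on the next. This makes it comparable
  with \<open>right_avg_ge\<close> for the next interval.\<close>

lemma history_coeff_le:
  assumes "1 \<le> k" "k + 1 < n" "n \<le> N"
  shows "\<rho> k * b n k \<le> \<tau> (k + 1) * \<psi> n (t k) / 3"
proof -
  have k: "1 \<le> k" "k < n" "n \<le> N" using assms by auto
  have pos: "0 < \<tau> k" "0 < \<tau> (k + 1)" "0 < \<rho> k" using step_pos ratio_pos assms by auto
  have r: "\<rho> k \<le> 7 / 4" using ratios assms by simp
  interpret convex_profile "\<phi> n" "\<psi> n" "t (k - 1)" "t k" by (rule profile[OF k])
  have "\<rho> k * b n k \<le> \<rho> k * (1 / (\<tau> k * (\<tau> k + \<tau> (k + 1))) * (\<psi> n (t k) * \<tau> k ^ 3 / 6))"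
    unfolding coeff_b_moment[OF k] 
    using product_moment_le pos by (intro mult_left_mono) (auto simp: step_def)
  also have "\<dots> = \<rho> k ^ 3 / (6 * (1 + \<rho> k)) * (\<tau> (k + 1) * \<psi> n (t k))"
  proof -
    have "r * (1 / (r * h * (r * h + h)) * (x * (r * h) ^ 3 / 6)) = r ^ 3 / (6 * (1 + r)) * (h * x)"
      if "0 < r" "0 < h" for r h x :: real
    proof -
      have "r * (1 / (r * h * (h * d)) * (x * (r * h) ^ 3 / 6)) = r ^ 3 / (6 * d) * (h * x)"
        if "d \<noteq> 0" for d
        using that \<open>0 < r\<close> \<open>0 < h\<close> by (simp add: field_simps power3_eq_cube)
      moreover have "r * h + h = h * (1 + r)" "1 + r \<noteq> 0"
        using that by (auto simp: algebra_simps)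
      ultimately show ?thesis by metis
    qed
    then show ?thesis unfolding step_ratio[OF k] using pos by blast
  qed
  also have "\<dots> \<le> 1 / 3 * (\<tau> (k + 1) * \<psi> n (t k))"
  proof (intro mult_right_mono)
    show "\<rho> k ^ 3 / (6 * (1 + \<rho> k)) \<le> 1 / 3"
      using ratio_cubed[of "\<rho> k"] pos r by (simp add: divide_simps)
    show "0 \<le> \<tau> (k + 1) * \<psi> n (t k)"
      using pos slope_pos[of "t k"] nonempty by (intro mult_nonneg_nonneg) auto
  qed
  finally show ?thesis by simp
qed

text \<open>The exceptional cases in the definition of the kernels amount to suppressing the correction
  from the preceding interval when \<open>k = 1\<close>, and the one from the interval itself when \<open>k = n\<close>. With
  these two terms a single formula covers all kernels, including \<open>n = 1\<close>.\<close>

definition history where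
  "history n k = (if k = 1 then 0 else \<rho> (k - 1) * b n (k - 1))"

definition current where
  "current n k = (if k = n then 0 else b n k)"

lemma kernel_A_eq:
  assumes "1 \<le> k" "k \<le> n"
  shows "kernel_A \<alpha> (\<alpha> / 2) t n (n - k) = a n k + history n k - current n k"
proof -
  have "n - (n - k) - 1 = k - 1" "n - k + 1 = n - (k - 1)" if "k \<noteq> n"
    using assms that by auto
  then show ?thesis using assms 
    by (auto simp: kernel_A_def history_def current_def)
qed

lemma history_nonneg:
  assumes "1 \<le> k" "k \<le> n" "n \<le> N"
  shows "0 \<le> history n k"
proof (cases "k = 1")
  case False
  then have "1 \<le> k - 1" "k - 1 < n" "k - 1 \<le> N - 1" using assms by auto
  then show ?thesis
    using mult_nonneg_nonneg[OF less_imp_le[OF ratio_pos] coeff_b_nonneg, of "k - 1" "k - 1" n]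
      False assms(3) by (simp add: history_def)
qed (simp add: history_def)

text \<open>With \<open>p = \<tau>\<^sub>k \<psi>(t\<^bsub>k-1\<^esub>) > 0\<close>, the history term is at most \<open>p / 3\<close>, whereas
  \<open>J\<^sub>k - I\<^sub>k / 5 \<ge> 4/5 J\<^sub>k \<ge> 2/5 p\<close>.\<close>

lemma right_avg_dominates:
  assumes "1 \<le> k" "k < n" "n \<le> N"
  shows "history n k + 1 / 5 * left_avg n k \<le> right_avg n k" and "history n k < right_avg n k"
proof -
  have pos: "0 < \<tau> k * \<psi> n (t (k - 1))"
    using convex_profile.slope_pos[OF profile[OF assms], of "t (k - 1)"] nodes[of k] step_pos[of k] assms
    by (intro mult_pos_pos) auto
  have h: "history n k \<le> \<tau> k * \<psi> n (t (k - 1)) / 3"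
    using history_coeff_le[of "k - 1" n] assms pos by (auto simp: history_def)
  show "history n k < right_avg n k" using h pos right_avg_ge[OF assms] by simp
  show "history n k + 1 / 5 * left_avg n k \<le> right_avg n k"
    using h pos right_avg_ge[OF assms] left_avg_le_right_avg[OF assms] by simp
qed

lemma last_ge_value:
  assumes "1 \<le> n" "n \<le> N"
  shows "\<phi> n (t (n - 1)) \<le> a n n"
proof -
  have "0 \<le> a n n"
    unfolding coeff_a_last[OF assms] using step_pos[OF assms] order_less_one
    by (intro divide_nonneg_pos less_imp_le[OF omega_pos]) auto
  then have "(1 - \<alpha>) / (1 - \<alpha> / 2) * a n n \<le> 1 * a n n"
    using order_pos order_less_one by (intro mult_right_mono) auto
  then show ?thesis unfolding coeff_a_last_eq_value[OF assms] by simp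
qed

text \<open>An average of an increasing function exceeds its left end value; the point is that it still
  does so after its own correction is subtracted. On the last interval, where the integration stops
  short of the right end, the explicit value takes over.\<close>

lemma next_ge_value:
  assumes "1 \<le> k" "k < n" "n \<le> N"
  shows "\<phi> n (t k) \<le> a n (k + 1) - current n (k + 1)"
proof (cases "k + 1 = n")
  case True
  then show ?thesis using last_ge_value[of n] assms by (auto simp: current_def)
next
  case False
  then show ?thesis
    using coeff_b_le_left_avg[of "k + 1" n] left_avg_eq[of "k + 1" n] assms
    by (simp add: current_def)
qed

section \<open>The kernels\<close>

lemma kernel_A_increment:
  assumes "1 \<le> k" "k < n" "n \<le> N"
  shows "(1 + \<rho> k) * b n k + 1 / 5 * left_avg n k
           \<le> kernel_A \<alpha> (\<alpha> / 2) t n (n - k - 1) - kernel_A \<alpha> (\<alpha> / 2) t n (n - k)"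
proof -
  have "kernel_A \<alpha> (\<alpha> / 2) t n (n - k - 1) = a n (k + 1) + \<rho> k * b n k - current n (k + 1)"
    using kernel_A_eq[of "k + 1" n] assms by (simp add: history_def)
  moreover have "kernel_A \<alpha> (\<alpha> / 2) t n (n - k) = a n k + history n k - b n k"
    using kernel_A_eq[of k n] assms by (simp add: current_def)
  ultimately show ?thesis
    using right_avg_dominates(1)[OF assms] next_ge_value[OF assms] right_avg_eq[OF assms]
    by (simp add: algebra_simps)
qed

lemma left_avg_varpi2:
  assumes "1 \<le> k" "k < n" "n \<le> N"
  shows "left_avg n k = 1 / \<tau> k * integral {t (k - 1)..t k} (\<lambda>s. (t k - s) * varpi2 \<alpha> (\<alpha> / 2) t n s)"
proof -
  have "t k < c n" using node_less_offset assms by simp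
  then show ?thesis unfolding left_avg_def
    by (intro arg_cong[where f = "(*) _"] integral_cong)
       (auto simp: varpi2_eq[OF order_pos order_less_one])
qed

text \<open>After scaling, the leading kernel is at least \<open>\<phi>(t\<^bsub>n-1\<^esub>)\<close>, which leaves
  \<open>J\<^bsub>n-1\<^esub>\<close> to absorb the history term.\<close>

lemma kernel_A_sign_condition:
  assumes "2 \<le> n" "n \<le> N"
  shows "0 < (1 - \<alpha>) / (1 - \<alpha> / 2) * kernel_A \<alpha> (\<alpha> / 2) t n 0 - kernel_A \<alpha> (\<alpha> / 2) t n 1"
proof -
  have k: "1 \<le> n - 1" "n - 1 < n" "n \<le> N" using assms by auto
  have "kernel_A \<alpha> (\<alpha> / 2) t n 0 = a n n + history n n"
    using kernel_A_eq[of n n] assms by (simp add: current_def)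
  then have "(1 - \<alpha>) / (1 - \<alpha> / 2) * kernel_A \<alpha> (\<alpha> / 2) t n 0 =
      \<phi> n (t (n - 1)) + (1 - \<alpha>) / (1 - \<alpha> / 2) * history n n"
    using coeff_a_last_eq_value[of n] assms by (simp add: distrib_left)
  moreover have "0 \<le> (1 - \<alpha>) / (1 - \<alpha> / 2) * history n n"
    using history_nonneg[of n n] assms order_less_one by (intro mult_nonneg_nonneg) auto
  moreover have "kernel_A \<alpha> (\<alpha> / 2) t n 1 = a n (n - 1) + history n (n - 1) - b n (n - 1)"
    using kernel_A_eq[of "n - 1" n] assms by (simp add: current_def)
  ultimately show ?thesis
    using right_avg_dominates(2)[OF k] right_avg_eq[OF k] coeff_b_nonneg[OF k] by linarith
qed

lemma integral_last:
  assumes "1 \<le> n" "n \<le> N"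
  shows "integral {t (n - 1)..t n} (\<lambda>s. omega (1 - \<alpha>) (t n - s)) = omega (2 - \<alpha>) (\<tau> n)"
  using integral_unique[OF has_integral_omega[of \<alpha> "t (n - 1)" "t n" "t n"]]
    order_pos order_less_one nodes[OF assms]
  by (simp add: step_def)

lemma kernel_A_upper:
  assumes "1 \<le> n" "n \<le> N"
  shows "kernel_A \<alpha> (\<alpha> / 2) t n 0 \<le>
           24 / (11 * \<tau> n) * integral {t (n - 1)..t n} (\<lambda>s. omega (1 - \<alpha>) (t n - s))"
proof -
  have pos: "0 < \<tau> n" using step_pos[OF assms] .
  have an: "0 \<le> a n n"
    unfolding coeff_a_last[OF assms] using pos order_less_one
    by (intro divide_nonneg_pos less_imp_le[OF omega_pos]) auto
  have hist: "history n n \<le> 49 / 44 * a n n"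
  proof (cases "n = 1")
    case True
    then show ?thesis using an by (simp add: history_def)
  next
    case False
    define k where "k = n - 1"
    have k: "1 \<le> k" "k < n" "n \<le> N" and n: "n = k + 1" using False assms by (auto simp: k_def)
    have "\<rho> k * b n k \<le> 7 / 4 * (7 / 11 * a n k)"
      using ratios[of k] ratio_pos[of k] coeff_b_le_coeff_a[OF k] coeff_b_nonneg[OF k] k
      by (intro mult_mono) auto
    \<comment> \<open>both coefficients are compared with the value of \<open>\<phi>\<close> at the node between them\<close>
    also have "\<dots> \<le> 49 / 44 * a n n"
      using coeff_a_le_value[OF k] last_ge_value[OF assms] by (simp add: k_def)
    finally show ?thesis using False by (simp add: history_def k_def)
  qed
  have "omega (2 - \<alpha>) ((1 - \<alpha> / 2) * \<tau> n) \<le> omega (2 - \<alpha>) (\<tau> n)"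
    using order_pos order_less_one pos by (intro omega_mono) auto
  then have "a n n \<le> omega (2 - \<alpha>) (\<tau> n) / \<tau> n"
    unfolding coeff_a_last[OF assms] using pos by (intro divide_right_mono) auto
  then have "a n n + history n n \<le> 24 / 11 * (omega (2 - \<alpha>) (\<tau> n) / \<tau> n)"
    using hist an by linarith
  then show ?thesis
    using kernel_A_eq[of n n] assms unfolding integral_last[OF assms] by (simp add: current_def)
qed

lemma kernel_A_lower:
  assumes "1 \<le> k" "k \<le> n" "n \<le> N"
  shows "4 / (11 * \<tau> k) * integral {t (k - 1)..t k} (\<lambda>s. omega (1 - \<alpha>) (t n - s))
           \<le> kernel_A \<alpha> (\<alpha> / 2) t n (n - k)"
proof (cases "k = n")
  case True
  have n: "1 \<le> n" "n \<le> N" using assms by auto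
  have pos: "0 < \<tau> n" using step_pos[OF n] .
  have om: "0 < omega (2 - \<alpha>) (\<tau> n)" using pos order_less_one by (intro omega_pos) auto
  \<comment> \<open>\<open>1 - \<alpha> / 2 > 1 / 2 > 4 / 11\<close>\<close>
  have "4 / 11 * omega (2 - \<alpha>) (\<tau> n) \<le> (1 - \<alpha> / 2) * omega (2 - \<alpha>) (\<tau> n)"
    using om order_less_one by (intro mult_right_mono) auto
  also have "\<dots> \<le> omega (2 - \<alpha>) ((1 - \<alpha> / 2) * \<tau> n)"
    using order_pos order_less_one pos by (intro omega_scale_ge) auto
  finally have "4 / 11 * omega (2 - \<alpha>) (\<tau> n) / \<tau> n \<le> a n n"
    unfolding coeff_a_last[OF n] using pos by (intro divide_right_mono) auto
  then show ?thesis
    using True kernel_A_eq[of n n] history_nonneg[of n n] n integral_last[OF n]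
    by (simp add: current_def)
next
  case False
  then have k: "1 \<le> k" "k < n" "n \<le> N" using assms by auto
  have pos: "0 < \<tau> k" using step_pos k by simp
  have less: "t k < c n" "c n \<le> t n" using node_less_offset[of k n] offset_le_right[of n] k by auto
  \<comment> \<open>moving the singularity from \<open>t n\<close> back to \<open>c n\<close> only enlarges the integrand\<close>
  have "integral {t (k - 1)..t k} (\<lambda>s. omega (1 - \<alpha>) (t n - s)) \<le> integral {t (k - 1)..t k} (\<phi> n)"
  proof (rule integral_le)
    show "(\<lambda>s. omega (1 - \<alpha>) (t n - s)) integrable_on {t (k - 1)..t k}"
      using has_integral_omega[of \<alpha> "t (k - 1)" "t k" "t n"] nodes[of k] less k order_pos order_less_one
      by (auto simp: integrable_on_def)
    show "\<phi> n integrable_on {t (k - 1)..t k}"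
      by (rule convex_profile.integrals_exist(1)[OF profile[OF k]])
  qed (use less order_pos order_less_one in \<open>auto intro!: omega_antimono\<close>)
  then have "4 / (11 * \<tau> k) * integral {t (k - 1)..t k} (\<lambda>s. omega (1 - \<alpha>) (t n - s)) \<le>
      4 / (11 * \<tau> k) * integral {t (k - 1)..t k} (\<phi> n)"
    using pos by (intro mult_left_mono) auto
  also have "\<dots> = 4 / 11 * a n k" by (simp add: coeff_a_interior[OF k])
  also have "\<dots> \<le> kernel_A \<alpha> (\<alpha> / 2) t n (n - k)"
    using kernel_A_eq[of k n] history_nonneg[of k n] coeff_b_le_coeff_a[OF k] k
    by (simp add: current_def)
  finally show ?thesis .
qed

end


section \<open>The properties of the kernels\<close>

theorem theorem2p2:
  fixes \<alpha> \<theta> T :: real and t :: "nat \<Rightarrow> real" and N :: nat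
  assumes "0 < \<alpha>" and "\<alpha> < 1" and "\<theta> = \<alpha> / 2"
    and "1 \<le> N" and "t 0 = 0" and "t N = T"
    and "\<And>k. 1 \<le> k \<Longrightarrow> k \<le> N \<Longrightarrow> t (k - 1) < t k"
    and "\<And>k. 1 \<le> k \<Longrightarrow> k \<le> N - 1 \<Longrightarrow> ratio t k \<le> 7 / 4"
  shows "(\<forall>n. 1 \<le> n \<and> n \<le> N \<longrightarrow>
            kernel_A \<alpha> \<theta> t n 0
              \<le> 24 / (11 * step t n) * integral {t (n - 1)..t n} (\<lambda>s. omega (1 - \<alpha>) (t n - s))
            \<and> (\<forall>k. 1 \<le> k \<and> k \<le> n \<longrightarrow>
                 kernel_A \<alpha> \<theta> t n (n - k)
                   \<ge> 4 / (11 * step t k) * integral {t (k - 1)..t k} (\<lambda>s. omega (1 - \<alpha>) (t n - s))))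
       \<and> (\<forall>n k. 2 \<le> n \<and> n \<le> N \<and> 1 \<le> k \<and> k \<le> n - 1 \<longrightarrow>
            kernel_A \<alpha> \<theta> t n (n - k - 1) - kernel_A \<alpha> \<theta> t n (n - k)
              \<ge> (1 + ratio t k) * coeff_b \<alpha> \<theta> t n (n - k)
                + 1 / (5 * step t k)
                  * integral {t (k - 1)..t k} (\<lambda>s. (t k - s) * varpi2 \<alpha> \<theta> t n s))
       \<and> (\<forall>n. 2 \<le> n \<and> n \<le> N \<longrightarrow>
            (1 - 2 * \<theta>) / (1 - \<theta>) * kernel_A \<alpha> \<theta> t n 0 - kernel_A \<alpha> \<theta> t n 1 > 0)"
proof -
  interpret alikhanov_mesh \<alpha> t N
    using assms by unfold_locales auto
  have II: "(1 + ratio t k) * coeff_b \<alpha> \<theta> t n (n - k)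
        + 1 / (5 * step t k) * integral {t (k - 1)..t k} (\<lambda>s. (t k - s) * varpi2 \<alpha> \<theta> t n s)
      \<le> kernel_A \<alpha> \<theta> t n (n - k - 1) - kernel_A \<alpha> \<theta> t n (n - k)"
    if "2 \<le> n" "n \<le> N" "1 \<le> k" "k \<le> n - 1" for n k
  proof -
    have k: "1 \<le> k" "k < n" "n \<le> N" using that by auto
    show ?thesis
      using kernel_A_increment[OF k] unfolding left_avg_varpi2[OF k] \<open>\<theta> = \<alpha> / 2\<close> by simp
  qed
  have III: "0 < (1 - 2 * \<theta>) / (1 - \<theta>) * kernel_A \<alpha> \<theta> t n 0 - kernel_A \<alpha> \<theta> t n 1"
    if "2 \<le> n" "n \<le> N" for n
    using kernel_A_sign_condition[OF that] unfolding \<open>\<theta> = \<alpha> / 2\<close> by simp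
  show ?thesis
    using kernel_A_upper kernel_A_lower II III \<open>\<theta> = \<alpha> / 2\<close> by blast
qed

end
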